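(* Let $X$ be an infinite dimensional Banach space whose norm locally depends upon finitely many coordinates and let $Y$ be an infinite dimensional Hilbert space. Then $$\operatorname{NA}_\pi(X\widehat{\otimes}_\pi Y)\subseteq X\otimes Y,$$ that is, every tensor in $X\widehat{\otimes}_\pi Y$ which attains its projective norm is a finite sum of basic tensors $x\otimes y$. In particular, there are tensors in $X\widehat{\otimes}_\pi Y$ which do not attain their projective norm.
   Context: All Banach and Hilbert spaces are real. The projective tensor product $X\widehat{\otimes}_\pi Y$ is the completion of the algebraic tensor product $X\otimes Y$ under the norm $\|z\|_\pi=\inf\{\sum_{i=1}^n\|x_i\|\|y_i\|: z=\sum_{i=1}^n x_i\otimes y_i\}$; $X\otimes Y$ is regarded as a subspace of $X\widehat{\otimes}_\pi Y$. An element $z\in X\widehat{\otimes}_\pi Y$ attains its projective norm if there exist sequences $(x_n)$ in $X$ and $(y_n)$ in $Y$ such that $\|z\|_\pi=\sum_{n=1}^\infty\|x_n\|\|y_n\|$ and $z=\sum_{n=1}^\infty x_n\otimes y_n$ (norm convergence in $X\widehat{\otimes}_\pi Y$). $\operatorname{NA}_\pi(X\widehat{\otimes}_\pi Y)$ denotes the set of all such $z$. The norm of a Banach space $X$ locally depends upon finitely many coordinates if for every $x\in X\setminus\{0\}$ there exist $\varepsilon>0$, a finite subset $\{f_1,\ldots,f_N\}\subseteq X^*$ and a continuous function $\varphi:\mathbb{R}^N\longrightarrow\mathbb{R}$ such that $\|y\|=\varphi(f_1(y),\ldots,f_N(y))$ for every $y\in X$ with $\|y-x\|<\varepsilon$.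 *)

theory Defs
  imports "HOL-Analysis.Analysis" "HOL-Analysis.Finite_Function_Topology"
begin

section \<open>The algebraic tensor product\<close>

text \<open>
  The free real vector space on \<open>'a \<times> 'b\<close> is \<open>('a \<times> 'b) \<Rightarrow>\<^sub>0 real\<close>. The algebraic tensor product
  is its quotient by the subspace spanned by the bilinearity relations.
\<close>

definition bilinearity_relations :: "('a::real_vector \<times> 'b::real_vector \<Rightarrow>\<^sub>0 real) set" where
  "bilinearity_relations =
     {Poly_Mapping.single (x + x', y) 1 - Poly_Mapping.single (x, y) 1
        - Poly_Mapping.single (x', y) 1 | x x' y. True} \<union>
     {Poly_Mapping.single (x, y + y') 1 - Poly_Mapping.single (x, y) 1
        - Poly_Mapping.single (x, y') 1 | x y y'. True} \<union>
     {Poly_Mapping.single (r *\<^sub>R x, y) 1 - r *\<^sub>R Poly_Mapping.single (x, y) 1 | r x y. True} \<union>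
     {Poly_Mapping.single (x, r *\<^sub>R y) 1 - r *\<^sub>R Poly_Mapping.single (x, y) 1 | r x y. True}"

definition tensor_rel ::
    "('a::real_vector \<times> 'b::real_vector \<Rightarrow>\<^sub>0 real) \<Rightarrow> ('a \<times> 'b \<Rightarrow>\<^sub>0 real) \<Rightarrow> bool" where
  "tensor_rel u v \<longleftrightarrow> u - v \<in> span bilinearity_relations"

lemma equivp_tensor_rel: "equivp tensor_rel"
proof (rule equivpI)
  show "reflp tensor_rel"
    by (simp add: reflp_def tensor_rel_def span_zero)
  show "symp tensor_rel"
    unfolding symp_def tensor_rel_def using span_neg by fastforce
  show "transp tensor_rel"
    unfolding transp_def tensor_rel_def using span_add by fastforce
qed

quotient_type (overloaded) ('a, 'b) tensor =
  "'a::real_vector \<times> 'b::real_vector \<Rightarrow>\<^sub>0 real" / tensor_rel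
  by (rule equivp_tensor_rel)

instantiation tensor :: (real_vector, real_vector) real_vector
begin

lift_definition zero_tensor :: "('a, 'b) tensor" is 0 .

lift_definition plus_tensor :: "('a, 'b) tensor \<Rightarrow> ('a, 'b) tensor \<Rightarrow> ('a, 'b) tensor" is "(+)"
  unfolding tensor_rel_def by (simp only: add_diff_add span_add)

lift_definition uminus_tensor :: "('a, 'b) tensor \<Rightarrow> ('a, 'b) tensor" is uminus
  unfolding tensor_rel_def by (simp only: minus_diff_minus span_neg)

lift_definition minus_tensor :: "('a, 'b) tensor \<Rightarrow> ('a, 'b) tensor \<Rightarrow> ('a, 'b) tensor" is "(-)"
  unfolding tensor_rel_def
proof -
  fix a b c d :: "'a \<times> 'b \<Rightarrow>\<^sub>0 real"
  assume "a - b \<in> span bilinearity_relations" "c - d \<in> span bilinearity_relations"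
  then have "(a - b) - (c - d) \<in> span bilinearity_relations"
    by (rule span_diff)
  then show "(a - c) - (b - d) \<in> span bilinearity_relations"
    by (simp add: algebra_simps)
qed

lift_definition scaleR_tensor :: "real \<Rightarrow> ('a, 'b) tensor \<Rightarrow> ('a, 'b) tensor" is "(*\<^sub>R)"
  unfolding tensor_rel_def by (simp only: span_scale flip: scaleR_diff_right)

instance
proof
  fix a b c :: "('a, 'b) tensor" and r s :: real
  show "a + b + c = a + (b + c)"
    by transfer (simp add: tensor_rel_def span_zero add.assoc)
  show "a + b = b + a"
    by transfer (simp add: tensor_rel_def span_zero add.commute)
  show "0 + a = a"
    by transfer (simp add: tensor_rel_def span_zero)
  show "- a + a = 0"
    by transfer (simp add: tensor_rel_def span_zero)
  show "a - b = a + - b"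
    by transfer (simp add: tensor_rel_def span_zero)
  show "r *\<^sub>R (a + b) = r *\<^sub>R a + r *\<^sub>R b"
    by transfer (simp add: tensor_rel_def span_zero scaleR_add_right)
  show "(r + s) *\<^sub>R a = r *\<^sub>R a + s *\<^sub>R a"
    by transfer (simp add: tensor_rel_def span_zero scaleR_add_left)
  show "r *\<^sub>R s *\<^sub>R a = (r * s) *\<^sub>R a"
    by transfer (simp add: tensor_rel_def span_zero)
  show "1 *\<^sub>R a = a"
    by transfer (simp add: tensor_rel_def span_zero)
qed

end

lift_definition pure_tensor :: "'a::real_vector \<Rightarrow> 'b::real_vector \<Rightarrow> ('a, 'b) tensor"
  is "\<lambda>x y. Poly_Mapping.single (x, y) 1" .

lemma bilinearity_relation_eq:
  "u - v \<in> bilinearity_relations \<Longrightarrow> tensor_rel u v"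
  by (simp add: tensor_rel_def span_base)

lemma pure_tensor_add_left: "pure_tensor (x + x') y = pure_tensor x y + pure_tensor x' y"
  by transfer (rule bilinearity_relation_eq, unfold bilinearity_relations_def diff_diff_eq[symmetric], blast)

lemma pure_tensor_add_right: "pure_tensor x (y + y') = pure_tensor x y + pure_tensor x y'"
  by transfer (rule bilinearity_relation_eq, unfold bilinearity_relations_def diff_diff_eq[symmetric], blast)

lemma pure_tensor_scaleR_left: "pure_tensor (r *\<^sub>R x) y = r *\<^sub>R pure_tensor x y"
  by transfer (rule bilinearity_relation_eq, unfold bilinearity_relations_def, blast)

lemma pure_tensor_scaleR_right: "pure_tensor x (r *\<^sub>R y) = r *\<^sub>R pure_tensor x y"
  by transfer (rule bilinearity_relation_eq, unfold bilinearity_relations_def, blast)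

lemma tensor_exists_sum:
  "\<exists>ts. (z :: ('a::real_vector, 'b::real_vector) tensor) = (\<Sum>(x, y)\<leftarrow>ts. pure_tensor x y)"
proof (induction z rule: tensor.abs_induct)
  case (1 u)
  show ?case
  proof (induction u rule: Poly_Mapping.update_induct)
    case const
    have "abs_tensor 0 = (\<Sum>(x, y)\<leftarrow>[]. pure_tensor x y :: ('a, 'b) tensor)"
      by (simp add: zero_tensor.abs_eq)
    then show ?case by blast
  next
    case (update f p r)
    then obtain ts where ts: "abs_tensor f = (\<Sum>(x, y)\<leftarrow>ts. pure_tensor x y :: ('a, 'b) tensor)"
      by blast
    obtain a b where p: "p = (a, b)" by fastforce
    have "Poly_Mapping.update p r f = r *\<^sub>R Poly_Mapping.single p 1 + f"
      using update.hyps
      by (intro poly_mapping_eqI)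
        (auto simp: lookup_update lookup_add lookup_single when_def in_keys_iff
          scaleR_poly_mapping_def)
    then have "abs_tensor (Poly_Mapping.update p r f) = r *\<^sub>R pure_tensor a b + abs_tensor f"
      by (simp add: p plus_tensor.abs_eq scaleR_tensor.abs_eq pure_tensor.abs_eq)
    then have "abs_tensor (Poly_Mapping.update p r f)
        = (\<Sum>(x, y)\<leftarrow>(r *\<^sub>R a, b) # ts. pure_tensor x y :: ('a, 'b) tensor)"
      by (simp add: ts pure_tensor_scaleR_left)
    then show ?case by blast
  qed
qed

section \<open>The projective norm\<close>

definition projective_norm :: "('a::real_normed_vector, 'b::real_normed_vector) tensor \<Rightarrow> real" where
  "projective_norm z =
     Inf {\<Sum>(x, y)\<leftarrow>ts. norm x * norm y | ts. z = (\<Sum>(x, y)\<leftarrow>ts. pure_tensor x y)}"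

lemma sum_list_norm_nonneg: "0 \<le> (\<Sum>(x, y)\<leftarrow>ts. norm x * norm y)"
  by (rule sum_list_nonneg) auto

lemma projective_norm_nonneg: "0 \<le> projective_norm z"
  unfolding projective_norm_def
  by (rule cInf_greatest) (use tensor_exists_sum[of z] in \<open>auto simp: sum_list_norm_nonneg\<close>)

lemma projective_norm_le:
  "projective_norm (\<Sum>(x, y)\<leftarrow>ts. pure_tensor x y) \<le> (\<Sum>(x, y)\<leftarrow>ts. norm x * norm y)"
  unfolding projective_norm_def
  by (rule cInf_lower) (auto intro!: bdd_belowI[of _ 0] simp: sum_list_norm_nonneg)

lemma projective_norm_less:
  assumes "projective_norm z < c"
  shows "\<exists>ts. z = (\<Sum>(x, y)\<leftarrow>ts. pure_tensor x y) \<and> (\<Sum>(x, y)\<leftarrow>ts. norm x * norm y) < c"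
proof -
  let ?S = "{\<Sum>(x, y)\<leftarrow>ts. norm x * norm y | ts. z = (\<Sum>(x, y)\<leftarrow>ts. pure_tensor x y)}"
  have "?S \<noteq> {}" using tensor_exists_sum[of z] by blast
  moreover have "Inf ?S < c" using assms by (simp add: projective_norm_def)
  ultimately have "\<exists>s\<in>?S. s < c"
    by (rule cInf_lessD)
  then show ?thesis by blast
qed

lemma projective_norm_zero [simp]: "projective_norm 0 = 0"
  by (rule antisym[OF _ projective_norm_nonneg]) (use projective_norm_le[of "[]"] in simp)

lemma projective_norm_triangle:
  "projective_norm (z + w) \<le> projective_norm z + projective_norm w"
proof (rule field_le_epsilon)
  fix e :: real assume e: "e > 0"
  obtain ts where ts: "z = (\<Sum>(x, y)\<leftarrow>ts. pure_tensor x y)"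
    "(\<Sum>(x, y)\<leftarrow>ts. norm x * norm y) < projective_norm z + e / 2"
    using projective_norm_less[of z "projective_norm z + e / 2"] e by auto
  obtain us where us: "w = (\<Sum>(x, y)\<leftarrow>us. pure_tensor x y)"
    "(\<Sum>(x, y)\<leftarrow>us. norm x * norm y) < projective_norm w + e / 2"
    using projective_norm_less[of w "projective_norm w + e / 2"] e by auto
  have "projective_norm (z + w) \<le> (\<Sum>(x, y)\<leftarrow>ts @ us. norm x * norm y)"
    using projective_norm_le[of "ts @ us"] ts us by simp
  then show "projective_norm (z + w) \<le> projective_norm z + projective_norm w + e"
    using ts us by simp
qed

lemma projective_norm_scaleR_le:
  "projective_norm (r *\<^sub>R z) \<le> \<bar>r\<bar> * projective_norm z"
proof (cases "r = 0")
  case False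
  show ?thesis
  proof (rule field_le_epsilon)
    fix e :: real assume e: "e > 0"
    obtain ts where ts: "z = (\<Sum>(x, y)\<leftarrow>ts. pure_tensor x y)"
      "(\<Sum>(x, y)\<leftarrow>ts. norm x * norm y) < projective_norm z + e / \<bar>r\<bar>"
      using projective_norm_less[of z "projective_norm z + e / \<bar>r\<bar>"] e False by auto
    let ?us = "map (\<lambda>(x, y). (r *\<^sub>R x, y)) ts"
    have "r *\<^sub>R z = (\<Sum>(x, y)\<leftarrow>?us. pure_tensor x y)"
      unfolding ts(1) by (induction ts) (auto simp: scaleR_add_right pure_tensor_scaleR_left)
    moreover have "(\<Sum>(x, y)\<leftarrow>?us. norm x * norm y) = \<bar>r\<bar> * (\<Sum>(x, y)\<leftarrow>ts. norm x * norm y)"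
      by (induction ts) (auto simp: algebra_simps)
    ultimately have "projective_norm (r *\<^sub>R z) \<le> \<bar>r\<bar> * (\<Sum>(x, y)\<leftarrow>ts. norm x * norm y)"
      using projective_norm_le[of ?us] by simp
    also have "\<dots> \<le> \<bar>r\<bar> * (projective_norm z + e / \<bar>r\<bar>)"
      using ts by (intro mult_left_mono) auto
    also have "\<dots> = \<bar>r\<bar> * projective_norm z + e"
      using False by (simp add: field_simps)
    finally show "projective_norm (r *\<^sub>R z) \<le> \<bar>r\<bar> * projective_norm z + e" .
  qed
qed simp

lemma projective_norm_scaleR: "projective_norm (r *\<^sub>R z) = \<bar>r\<bar> * projective_norm z"
proof (cases "r = 0")
  case False
  have "\<bar>r\<bar> * projective_norm (inverse r *\<^sub>R r *\<^sub>R z)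
      \<le> \<bar>r\<bar> * (\<bar>inverse r\<bar> * projective_norm (r *\<^sub>R z))"
    by (rule mult_left_mono[OF projective_norm_scaleR_le]) simp
  then have "\<bar>r\<bar> * projective_norm z \<le> projective_norm (r *\<^sub>R z)"
    using False by (simp flip: mult.assoc abs_mult)
  then show ?thesis using projective_norm_scaleR_le[of r z] by linarith
qed simp

lemma projective_norm_minus: "projective_norm (- z) = projective_norm z"
  using projective_norm_scaleR[of "-1" z] by simp

lemma projective_norm_minus_commute: "projective_norm (z - w) = projective_norm (w - z)"
  using projective_norm_minus[of "z - w"] by simp

lemma projective_norm_triangle3:
  "\<bar>projective_norm z - projective_norm w\<bar> \<le> projective_norm (z - w)"
  using projective_norm_triangle[of "z - w" w] projective_norm_triangle[of "w - z" z]
    projective_norm_minus_commute[of z w] by simp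

section \<open>The projective tensor product\<close>

text \<open>
  The completion of the algebraic tensor product under the projective norm: Cauchy sequences
  modulo null sequences. (Building the completion this way uses only that the projective norm
  is a seminorm.)
\<close>

definition projective_Cauchy ::
    "(nat \<Rightarrow> ('a::real_normed_vector, 'b::real_normed_vector) tensor) \<Rightarrow> bool" where
  "projective_Cauchy s \<longleftrightarrow> (\<forall>e>0. \<exists>N. \<forall>m\<ge>N. \<forall>n\<ge>N. projective_norm (s m - s n) < e)"

definition proj_tensor_rel ::
    "(nat \<Rightarrow> ('a::real_normed_vector, 'b::real_normed_vector) tensor)
      \<Rightarrow> (nat \<Rightarrow> ('a, 'b) tensor) \<Rightarrow> bool" where
  "proj_tensor_rel s t \<longleftrightarrow> projective_Cauchy s \<and> projective_Cauchy t
     \<and> (\<lambda>n. projective_norm (s n - t n)) \<longlonglongrightarrow> 0"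

lemma projective_Cauchy_const [simp]: "projective_Cauchy (\<lambda>n. z)"
  by (simp add: projective_Cauchy_def)

lemma proj_tensor_rel_refl [simp]: "proj_tensor_rel s s \<longleftrightarrow> projective_Cauchy s"
  by (simp add: proj_tensor_rel_def)

lemma projective_null_add:
  assumes "(\<lambda>n. projective_norm (s n)) \<longlonglongrightarrow> 0" "(\<lambda>n. projective_norm (t n)) \<longlonglongrightarrow> 0"
  shows "(\<lambda>n. projective_norm (s n + t n)) \<longlonglongrightarrow> 0"
proof (rule tendsto_sandwich[of "\<lambda>n. 0"])
  show "(\<lambda>n. projective_norm (s n) + projective_norm (t n)) \<longlonglongrightarrow> 0"
    using tendsto_add[OF assms] by simp
qed (auto simp: projective_norm_nonneg projective_norm_triangle)

lemma part_equivp_proj_tensor_rel: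
  "part_equivp (proj_tensor_rel :: (nat \<Rightarrow> ('a::real_normed_vector, 'b::real_normed_vector) tensor) \<Rightarrow> _)"
proof (rule part_equivpI)
  show "\<exists>s :: nat \<Rightarrow> ('a, 'b) tensor. proj_tensor_rel s s"
    by (rule exI[of _ "\<lambda>n. 0"]) simp
  show "symp (proj_tensor_rel :: (nat \<Rightarrow> ('a, 'b) tensor) \<Rightarrow> _)"
    unfolding symp_def proj_tensor_rel_def by (simp add: projective_norm_minus_commute)
  show "transp (proj_tensor_rel :: (nat \<Rightarrow> ('a, 'b) tensor) \<Rightarrow> _)"
    unfolding transp_def proj_tensor_rel_def
  proof safe
    fix s t u :: "nat \<Rightarrow> ('a, 'b) tensor"
    assume "(\<lambda>n. projective_norm (s n - t n)) \<longlonglongrightarrow> 0" "(\<lambda>n. projective_norm (t n - u n)) \<longlonglongrightarrow> 0"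
    then show "(\<lambda>n. projective_norm (s n - u n)) \<longlonglongrightarrow> 0"
      using projective_null_add[of "\<lambda>n. s n - t n" "\<lambda>n. t n - u n"] by simp
  qed
qed

quotient_type (overloaded) ('a, 'b) proj_tensor =
  "nat \<Rightarrow> ('a::real_normed_vector, 'b::real_normed_vector) tensor" / partial: proj_tensor_rel
  by (rule part_equivp_proj_tensor_rel)

lemma projective_Cauchy_add:
  assumes "projective_Cauchy s" "projective_Cauchy t"
  shows "projective_Cauchy (\<lambda>n. s n + t n)"
  unfolding projective_Cauchy_def
proof safe
  fix e :: real assume "e > 0"
  then have e: "e / 2 > 0" by simp
  obtain M where M: "\<And>m n. m \<ge> M \<Longrightarrow> n \<ge> M \<Longrightarrow> projective_norm (s m - s n) < e / 2"
    using assms(1) e unfolding projective_Cauchy_def by blast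
  obtain N where N: "\<And>m n. m \<ge> N \<Longrightarrow> n \<ge> N \<Longrightarrow> projective_norm (t m - t n) < e / 2"
    using assms(2) e unfolding projective_Cauchy_def by blast
  have "projective_norm (s m + t m - (s n + t n)) < e" if "m \<ge> max M N" "n \<ge> max M N" for m n
    using M[of m n] N[of m n] that projective_norm_triangle[of "s m - s n" "t m - t n"]
    by (simp add: add_diff_add)
  then show "\<exists>N. \<forall>m\<ge>N. \<forall>n\<ge>N. projective_norm (s m + t m - (s n + t n)) < e" by blast
qed

lemma projective_Cauchy_scaleR:
  assumes "projective_Cauchy s"
  shows "projective_Cauchy (\<lambda>n. r *\<^sub>R s n)"
proof (cases "r = 0")
  case False
  show ?thesis
    unfolding projective_Cauchy_def
  proof safe
    fix e :: real assume "e > 0"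
    then have "e / \<bar>r\<bar> > 0" using False by simp
    then obtain M where M: "\<And>m n. m \<ge> M \<Longrightarrow> n \<ge> M \<Longrightarrow> projective_norm (s m - s n) < e / \<bar>r\<bar>"
      using assms unfolding projective_Cauchy_def by blast
    have "projective_norm (r *\<^sub>R s m - r *\<^sub>R s n) < e" if "m \<ge> M" "n \<ge> M" for m n
    proof -
      have "projective_norm (r *\<^sub>R s m - r *\<^sub>R s n) = \<bar>r\<bar> * projective_norm (s m - s n)"
        by (metis projective_norm_scaleR scaleR_diff_right)
      then show ?thesis using M[OF that] False by (simp add: field_simps)
    qed
    then show "\<exists>N. \<forall>m\<ge>N. \<forall>n\<ge>N. projective_norm (r *\<^sub>R s m - r *\<^sub>R s n) < e" by blast
  qed
qed simp

lemma projective_Cauchy_minus: "projective_Cauchy s \<Longrightarrow> projective_Cauchy (\<lambda>n. - s n)"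
  using projective_Cauchy_scaleR[of s "-1"] by simp

lemma projective_Cauchy_diff:
  "projective_Cauchy s \<Longrightarrow> projective_Cauchy t \<Longrightarrow> projective_Cauchy (\<lambda>n. s n - t n)"
  using projective_Cauchy_add[of s "\<lambda>n. - t n"] projective_Cauchy_minus[of t] by simp

lemma projective_Cauchy_convergent_norm:
  assumes "projective_Cauchy s"
  shows "convergent (\<lambda>n. projective_norm (s n))"
proof -
  have "Cauchy (\<lambda>n. projective_norm (s n))"
  proof (rule CauchyI)
    fix e :: real assume "e > 0"
    then obtain M where "\<And>m n. m \<ge> M \<Longrightarrow> n \<ge> M \<Longrightarrow> projective_norm (s m - s n) < e"
      using assms unfolding projective_Cauchy_def by blast
    then have "\<forall>m\<ge>M. \<forall>n\<ge>M. norm (projective_norm (s m) - projective_norm (s n)) < e"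
      unfolding real_norm_def using projective_norm_triangle3 order.strict_trans1 by blast
    then show "\<exists>M. \<forall>m\<ge>M. \<forall>n\<ge>M. norm (projective_norm (s m) - projective_norm (s n)) < e"
      by blast
  qed
  then show ?thesis by (rule Cauchy_convergent)
qed

lemma projective_norm_lim:
  "projective_Cauchy s \<Longrightarrow> (\<lambda>n. projective_norm (s n)) \<longlonglongrightarrow> lim (\<lambda>n. projective_norm (s n))"
  by (simp add: convergent_LIMSEQ_iff[symmetric] projective_Cauchy_convergent_norm)

instantiation proj_tensor :: (real_normed_vector, real_normed_vector) real_normed_vector
begin

lift_definition zero_proj_tensor :: "('a, 'b) proj_tensor" is "\<lambda>n. 0" by simp

lift_definition plus_proj_tensor ::
    "('a, 'b) proj_tensor \<Rightarrow> ('a, 'b) proj_tensor \<Rightarrow> ('a, 'b) proj_tensor"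
  is "\<lambda>s t n. s n + t n"
  unfolding proj_tensor_rel_def
  using projective_null_add by (fastforce simp: add_diff_add projective_Cauchy_add)

lift_definition uminus_proj_tensor :: "('a, 'b) proj_tensor \<Rightarrow> ('a, 'b) proj_tensor"
  is "\<lambda>s n. - s n"
  unfolding proj_tensor_rel_def
proof -
  fix s t :: "nat \<Rightarrow> ('a, 'b) tensor"
  assume st: "projective_Cauchy s \<and> projective_Cauchy t \<and> (\<lambda>n. projective_norm (s n - t n)) \<longlonglongrightarrow> 0"
  have "projective_norm (- s n - - t n) = projective_norm (s n - t n)" for n
    by (metis minus_diff_minus projective_norm_minus)
  then show "projective_Cauchy (\<lambda>n. - s n) \<and> projective_Cauchy (\<lambda>n. - t n)
      \<and> (\<lambda>n. projective_norm (- s n - - t n)) \<longlonglongrightarrow> 0"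
    using st by (simp only: projective_Cauchy_minus simp_thms)
qed

lift_definition scaleR_proj_tensor :: "real \<Rightarrow> ('a, 'b) proj_tensor \<Rightarrow> ('a, 'b) proj_tensor"
  is "\<lambda>r s n. r *\<^sub>R s n"
  unfolding proj_tensor_rel_def
  by (auto simp: projective_Cauchy_scaleR projective_norm_scaleR tendsto_mult_right_zero
      simp flip: scaleR_diff_right)

lift_definition norm_proj_tensor :: "('a, 'b) proj_tensor \<Rightarrow> real"
  is "\<lambda>s. lim (\<lambda>n. projective_norm (s n))"
proof -
  fix s t :: "nat \<Rightarrow> ('a, 'b) tensor"
  assume st: "proj_tensor_rel s t"
  have "(\<lambda>n. projective_norm (s n) - projective_norm (t n)) \<longlonglongrightarrow> 0"
    by (rule Lim_null_comparison[where g = "\<lambda>n. projective_norm (s n - t n)"])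
      (use st in \<open>auto simp: proj_tensor_rel_def projective_norm_triangle3\<close>)
  moreover have "(\<lambda>n. projective_norm (s n) - projective_norm (t n))
      \<longlonglongrightarrow> lim (\<lambda>n. projective_norm (s n)) - lim (\<lambda>n. projective_norm (t n))"
    using st by (intro tendsto_diff projective_norm_lim) (auto simp: proj_tensor_rel_def)
  ultimately show "lim (\<lambda>n. projective_norm (s n)) = lim (\<lambda>n. projective_norm (t n))"
    using LIMSEQ_unique by fastforce
qed

definition minus_proj_tensor ::
    "('a, 'b) proj_tensor \<Rightarrow> ('a, 'b) proj_tensor \<Rightarrow> ('a, 'b) proj_tensor"
  where "minus_proj_tensor z w = z + - w"

definition dist_proj_tensor :: "('a, 'b) proj_tensor \<Rightarrow> ('a, 'b) proj_tensor \<Rightarrow> real"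
  where "dist_proj_tensor z w = norm (z - w)"

definition sgn_proj_tensor :: "('a, 'b) proj_tensor \<Rightarrow> ('a, 'b) proj_tensor"
  where "sgn_proj_tensor z = inverse (norm z) *\<^sub>R z"

definition [code del]:
  "(uniformity :: (('a, 'b) proj_tensor \<times> ('a, 'b) proj_tensor) filter)
     = (INF e\<in>{0 <..}. principal {(z, w). dist z w < e})"

definition open_proj_tensor :: "('a, 'b) proj_tensor set \<Rightarrow> bool"
  where [code del]: "open_proj_tensor S = (\<forall>z\<in>S. \<forall>\<^sub>F (z', w) in uniformity. z' = z \<longrightarrow> w \<in> S)"

instance
proof
  fix a b c :: "('a, 'b) proj_tensor" and r s :: real
  show "a + b + c = a + (b + c)"
    by transfer (simp add: add.assoc projective_Cauchy_add)
  show "a + b = b + a"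
    by transfer (simp add: add.commute projective_Cauchy_add)
  show "0 + a = a"
    by transfer simp
  show "- a + a = 0"
    by transfer simp
  show "a - b = a + - b"
    by (simp add: minus_proj_tensor_def)
  show "r *\<^sub>R (a + b) = r *\<^sub>R a + r *\<^sub>R b"
    by transfer (simp add: scaleR_add_right projective_Cauchy_add projective_Cauchy_scaleR)
  show "(r + s) *\<^sub>R a = r *\<^sub>R a + s *\<^sub>R a"
    by transfer (simp add: scaleR_add_left projective_Cauchy_add projective_Cauchy_scaleR)
  show "r *\<^sub>R s *\<^sub>R a = (r * s) *\<^sub>R a"
    by transfer (simp add: projective_Cauchy_scaleR)
  show "1 *\<^sub>R a = a"
    by transfer simp
  show "dist a b = norm (a - b)"
    by (rule dist_proj_tensor_def)
  show "sgn a = inverse (norm a) *\<^sub>R a"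
    by (rule sgn_proj_tensor_def)
  show "(uniformity :: (('a, 'b) proj_tensor \<times> ('a, 'b) proj_tensor) filter)
     = (INF e\<in>{0 <..}. principal {(z, w). dist z w < e})"
    by (rule uniformity_proj_tensor_def)
  show "open S = (\<forall>z\<in>S. \<forall>\<^sub>F (z', w) in uniformity. z' = z \<longrightarrow> w \<in> S)"
    for S :: "('a, 'b) proj_tensor set"
    by (rule open_proj_tensor_def)
  show "norm a = 0 \<longleftrightarrow> a = 0"
  proof transfer
    fix s :: "nat \<Rightarrow> ('a, 'b) tensor"
    assume "proj_tensor_rel s s"
    then have s: "projective_Cauchy s" by simp
    show "lim (\<lambda>n. projective_norm (s n)) = 0 \<longleftrightarrow> proj_tensor_rel s (\<lambda>n. 0)"
    proof
      assume "lim (\<lambda>n. projective_norm (s n)) = 0"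
      then show "proj_tensor_rel s (\<lambda>n. 0)"
        using projective_norm_lim[OF s] s by (simp add: proj_tensor_rel_def)
    next
      assume "proj_tensor_rel s (\<lambda>n. 0)"
      then have "(\<lambda>n. projective_norm (s n)) \<longlonglongrightarrow> 0"
        by (simp add: proj_tensor_rel_def)
      then show "lim (\<lambda>n. projective_norm (s n)) = 0"
        by (rule limI)
    qed
  qed
  show "norm (a + b) \<le> norm a + norm b"
  proof transfer
    fix s t :: "nat \<Rightarrow> ('a, 'b) tensor"
    assume "proj_tensor_rel s s" "proj_tensor_rel t t"
    then have s: "projective_Cauchy s" and t: "projective_Cauchy t" by simp_all
    show "lim (\<lambda>n. projective_norm (s n + t n))
        \<le> lim (\<lambda>n. projective_norm (s n)) + lim (\<lambda>n. projective_norm (t n))"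
      by (rule LIMSEQ_le[OF projective_norm_lim[OF projective_Cauchy_add[OF s t]]
            tendsto_add[OF projective_norm_lim[OF s] projective_norm_lim[OF t]]])
        (blast intro: projective_norm_triangle)
  qed
  show "norm (r *\<^sub>R a) = \<bar>r\<bar> * norm a"
  proof transfer
    fix r :: real and s :: "nat \<Rightarrow> ('a, 'b) tensor"
    assume "proj_tensor_rel s s"
    then have "(\<lambda>n. \<bar>r\<bar> * projective_norm (s n)) \<longlonglongrightarrow> \<bar>r\<bar> * lim (\<lambda>n. projective_norm (s n))"
      by (intro tendsto_mult_left projective_norm_lim) simp
    then show "lim (\<lambda>n. projective_norm (r *\<^sub>R s n)) = \<bar>r\<bar> * lim (\<lambda>n. projective_norm (s n))"
      by (simp add: projective_norm_scaleR limI)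
  qed
qed

end

text \<open>
  \<open>X \<otimes> Y\<close>, regarded as a subspace of the completion, is \<open>range of_tensor\<close>.
\<close>

definition of_tensor ::
    "('a::real_normed_vector, 'b::real_normed_vector) tensor \<Rightarrow> ('a, 'b) proj_tensor" where
  "of_tensor z = abs_proj_tensor (\<lambda>n. z)"

lemma of_tensor_add: "of_tensor (z + w) = of_tensor z + of_tensor w"
  by (simp add: of_tensor_def plus_proj_tensor.abs_eq)

lemma of_tensor_scaleR: "of_tensor (r *\<^sub>R z) = r *\<^sub>R of_tensor z"
  by (simp add: of_tensor_def scaleR_proj_tensor.abs_eq)

lemma of_tensor_diff: "of_tensor (z - w) = of_tensor z - of_tensor w"
  using of_tensor_add[of "z - w" w] by (simp add: eq_diff_eq)

lemma norm_of_tensor: "norm (of_tensor z) = projective_norm z"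
  by (simp add: of_tensor_def norm_proj_tensor.abs_eq limI)

lemma abs_proj_tensor_limit:
  assumes "projective_Cauchy s"
  shows "(\<lambda>n. of_tensor (s n)) \<longlonglongrightarrow> abs_proj_tensor s"
proof (rule LIMSEQ_I)
  fix e :: real assume "e > 0"
  then have "e / 2 > 0" by simp
  then obtain N where N: "\<And>m n. m \<ge> N \<Longrightarrow> n \<ge> N \<Longrightarrow> projective_norm (s m - s n) < e / 2"
    using assms unfolding projective_Cauchy_def by blast
  have "norm (of_tensor (s m) - abs_proj_tensor s) < e" if "m \<ge> N" for m
  proof -
    have C: "projective_Cauchy (\<lambda>n. s m - s n)"
      using assms by (intro projective_Cauchy_diff) auto
    have "of_tensor (s m) - abs_proj_tensor s = abs_proj_tensor (\<lambda>n. s m - s n)"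
      using assms by (simp add: minus_proj_tensor_def of_tensor_def plus_proj_tensor.abs_eq
          uminus_proj_tensor.abs_eq projective_Cauchy_minus)
    then have "norm (of_tensor (s m) - abs_proj_tensor s) = lim (\<lambda>n. projective_norm (s m - s n))"
      using C by (simp add: norm_proj_tensor.abs_eq)
    also have "\<dots> \<le> e / 2"
      by (rule Lim_bounded[OF projective_norm_lim[OF C], of N]) (use N that in \<open>auto intro: less_imp_le\<close>)
    finally show ?thesis using \<open>e > 0\<close> by simp
  qed
  then show "\<exists>N. \<forall>m\<ge>N. norm (of_tensor (s m) - abs_proj_tensor s) < e" by blast
qed

lemma of_tensor_dense: "e > 0 \<Longrightarrow> \<exists>t. norm (z - of_tensor t) < e"
proof (induction z rule: proj_tensor.abs_induct)
  case (1 s)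
  then have "(\<lambda>n. of_tensor (s n)) \<longlonglongrightarrow> abs_proj_tensor s"
    by (intro abs_proj_tensor_limit) simp
  then obtain n where "norm (of_tensor (s n) - abs_proj_tensor s) < e"
    using LIMSEQ_D[OF _ \<open>e > 0\<close>] by blast
  then show ?case by (metis norm_minus_commute)
qed

instance proj_tensor :: (real_normed_vector, real_normed_vector) banach
proof
  fix X :: "nat \<Rightarrow> ('a, 'b) proj_tensor"
  assume X: "Cauchy X"
  have "\<forall>n. \<exists>t. norm (X n - of_tensor t) < inverse (real (Suc n))"
    by (intro allI of_tensor_dense) simp
  then obtain t where t: "\<And>n. norm (X n - of_tensor (t n)) < inverse (real (Suc n))"
    by metis
  have lim: "(\<lambda>n. of_tensor (t n) - X n) \<longlonglongrightarrow> 0"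
    by (rule Lim_null_comparison[OF _ LIMSEQ_inverse_real_of_nat])
      (use t in \<open>auto intro!: always_eventually less_imp_le simp: norm_minus_commute\<close>)
  have "projective_Cauchy t"
    unfolding projective_Cauchy_def
  proof safe
    fix e :: real assume "e > 0"
    then have e: "e / 3 > 0" by simp
    obtain M where M: "\<And>m n. m \<ge> M \<Longrightarrow> n \<ge> M \<Longrightarrow> norm (X m - X n) < e / 3"
      using CauchyD[OF X e] by blast
    obtain N where N: "\<And>n. n \<ge> N \<Longrightarrow> norm (of_tensor (t n) - X n) < e / 3"
      using LIMSEQ_D[OF lim e] by auto
    have "projective_norm (t m - t n) < e" if "m \<ge> max M N" "n \<ge> max M N" for m n
    proof -
      have "of_tensor (t m - t n) = (of_tensor (t m) - X m) + (X m - X n) - (of_tensor (t n) - X n)"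
        by (simp add: of_tensor_diff)
      then have "projective_norm (t m - t n) \<le>
          norm (of_tensor (t m) - X m) + norm (X m - X n) + norm (of_tensor (t n) - X n)"
        using norm_triangle_ineq4[of "(of_tensor (t m) - X m) + (X m - X n)" "of_tensor (t n) - X n"]
          norm_triangle_ineq[of "of_tensor (t m) - X m" "X m - X n"]
        unfolding norm_of_tensor[symmetric] by simp
      then show ?thesis using N[of m] N[of n] M[of m n] that by simp
    qed
    then show "\<exists>N. \<forall>m\<ge>N. \<forall>n\<ge>N. projective_norm (t m - t n) < e" by blast
  qed
  then have "(\<lambda>n. of_tensor (t n)) \<longlonglongrightarrow> abs_proj_tensor t"
    by (rule abs_proj_tensor_limit)
  from tendsto_diff[OF this lim] show "convergent X"
    by (auto simp: convergent_def)
qed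

section \<open>Norm attainment\<close>

definition NA_projective :: "('a::real_normed_vector, 'b::real_normed_vector) proj_tensor set" where
  "NA_projective = {z. \<exists>x y. (\<lambda>n. norm (x n) * norm (y n)) sums norm z
                       \<and> (\<lambda>n. of_tensor (pure_tensor (x n) (y n))) sums z}"

section \<open>Norms locally depending upon finitely many coordinates\<close>

text \<open>
  \<^term>\<open>Euclidean_space N\<close> is the library's \<open>\<real>\<^sup>N\<close> for a natural number \<open>N\<close>: sequences that vanish
  from index \<open>N\<close> on, with the product topology. The functionals are numbered from \<open>0\<close>.
\<close>

definition norm_locally_depends_finitely :: "'a::real_normed_vector itself \<Rightarrow> bool" where
  "norm_locally_depends_finitely (_ :: 'a itself) \<longleftrightarrow>
     (\<forall>x :: 'a. x \<noteq> 0 \<longrightarrow>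
       (\<exists>\<epsilon>>0. \<exists>N. \<exists>f :: nat \<Rightarrow> 'a \<Rightarrow>\<^sub>L real. \<exists>\<phi>.
          continuous_map (Euclidean_space N) euclideanreal \<phi> \<and>
          (\<forall>y. norm (y - x) < \<epsilon> \<longrightarrow>
             norm y = \<phi> (\<lambda>i. if i < N then blinfun_apply (f i) y else 0))))"

definition infinite_dimensional :: "'a::real_vector itself \<Rightarrow> bool" where
  "infinite_dimensional (_ :: 'a itself) \<longleftrightarrow> \<not> (\<exists>B :: 'a set. finite B \<and> span B = UNIV)"

end

theory Submission
  imports Defs
begin

text \<open>
  If \<open>\<Sum>n. x\<^sub>n \<otimes> y\<^sub>n\<close> attains the projective norm of \<open>z\<close>, a norming functional of \<open>z\<close> is a bilinear
  form \<open>b\<close> of norm one with \<open>b x\<^sub>n y\<^sub>n = norm x\<^sub>n * norm y\<^sub>n\<close> for all \<open>n\<close>. The norm of the first space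
  is locally constant along a subspace of finite codimension, and a functional attaining its norm
  at a given point of an inner product space is unique; so \<open>b\<close> has finite rank. It represents each
  \<open>y\<^sub>n\<close> up to a scalar, so the \<open>y\<^sub>n\<close> lie in a finite-dimensional space and the sum collapses to a
  finite one. Tensors of infinite rank exist, and they do not attain their norm.
\<close>

section \<open>Norming functionals\<close>

text \<open>Homogeneity is asked for only as an inequality, which is what infima deliver directly;
  scaling back by \<open>inverse r\<close> recovers equality.\<close>

definition sublinear_fun :: "('a::real_vector \<Rightarrow> real) \<Rightarrow> bool" where
  "sublinear_fun q \<longleftrightarrow> (\<forall>x y. q (x + y) \<le> q x + q y) \<and> (\<forall>r x. 0 \<le> r \<longrightarrow> q (r *\<^sub>R x) \<le> r * q x)"

lemma sublinear_fun_add: "sublinear_fun q \<Longrightarrow> q (x + y) \<le> q x + q y"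
  by (simp add: sublinear_fun_def)

lemma sublinear_fun_scaleR_le: "sublinear_fun q \<Longrightarrow> 0 \<le> r \<Longrightarrow> q (r *\<^sub>R x) \<le> r * q x"
  by (simp add: sublinear_fun_def)

lemma sublinear_fun_zero: "sublinear_fun q \<Longrightarrow> q 0 = 0"
  using sublinear_fun_add[of q 0 0] sublinear_fun_scaleR_le[of q 0 0] by simp

lemma sublinear_fun_scaleR:
  assumes "sublinear_fun q" "0 \<le> r"
  shows "q (r *\<^sub>R x) = r * q x"
proof (cases "r = 0")
  case False
  then have "q x \<le> inverse r * q (r *\<^sub>R x)"
    using sublinear_fun_scaleR_le[OF assms(1), of "inverse r" "r *\<^sub>R x"] assms(2) by simp
  then have "r * q x \<le> q (r *\<^sub>R x)"
    using False assms(2) by (simp add: field_simps)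
  then show ?thesis using sublinear_fun_scaleR_le[OF assms] by (simp add: antisym)
qed (simp add: sublinear_fun_zero assms)

lemma sublinear_fun_minus: "sublinear_fun q \<Longrightarrow> - q (- x) \<le> q x"
  using sublinear_fun_add[of q x "- x"] sublinear_fun_zero[of q] by simp

lemma sublinear_fun_norm: "sublinear_fun norm"
  by (simp add: sublinear_fun_def norm_triangle_ineq)

text \<open>Minimising \<open>q (x + t y) - t * q y\<close> over all \<open>t \<ge> 0\<close> gives
  \<open>q'\<close> with \<open>q' (- y) \<le> - q y\<close>, so a linear functional below
  \<open>q'\<close> takes the value \<open>q y\<close> at \<open>y\<close>. This serves both
  Hahn-Banach and the norming functionals.\<close>

lemma sublinear_fun_lower:
  fixes q :: "'a::real_vector \<Rightarrow> real"
  assumes q: "sublinear_fun q"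
  obtains q' where "sublinear_fun q'" "\<And>x. q' x \<le> q x" "\<And>x. q' x \<le> q (x + y) - q y"
proof -
  define q' where "q' = (\<lambda>x. INF t\<in>{0..}. q (x + t *\<^sub>R y) - t * q y)"
  have bdd: "bdd_below ((\<lambda>t. q (x + t *\<^sub>R y) - t * q y) ` {0..})" for x
  proof (rule bdd_belowI2)
    fix t :: real assume "t \<in> {0..}"
    then have "t * q y = q (t *\<^sub>R y)" using q by (simp add: sublinear_fun_scaleR)
    also have "\<dots> \<le> q (x + t *\<^sub>R y) + q (- x)"
      using sublinear_fun_add[OF q, of "x + t *\<^sub>R y" "- x"] by simp
    finally show "- q (- x) \<le> q (x + t *\<^sub>R y) - t * q y" by simp
  qed
  have le: "q' x \<le> q (x + t *\<^sub>R y) - t * q y" if "0 \<le> t" for x t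
    unfolding q'_def using that by (intro cINF_lower bdd) simp
  have "sublinear_fun q'"
    unfolding sublinear_fun_def
  proof (intro conjI allI impI)
    fix x x'
    \<comment> \<open>The parameters add up, so \<open>t\<close> and \<open>s\<close> vary
      independently and the two infima can be taken one after the other.\<close>
    have *: "q' (x + x') \<le> (q (x + t *\<^sub>R y) - t * q y) + (q (x' + s *\<^sub>R y) - s * q y)"
      if "0 \<le> t" "0 \<le> s" for t s
      using le[of "t + s" "x + x'"] that sublinear_fun_add[OF q, of "x + t *\<^sub>R y" "x' + s *\<^sub>R y"]
      by (simp add: algebra_simps)
    have "q' (x + x') - (q (x' + s *\<^sub>R y) - s * q y) \<le> q' x" if "0 \<le> s" for s
      unfolding q'_def[THEN fun_cong, of x]
      by (rule cINF_greatest) (use *[OF _ that] in \<open>auto simp: algebra_simps\<close>)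
    then have "q' (x + x') - q' x \<le> q' x'"
      unfolding q'_def[THEN fun_cong, of x']
      by (intro cINF_greatest) (auto simp: algebra_simps)
    then show "q' (x + x') \<le> q' x + q' x'" by simp
  next
    fix r :: real and x assume r: "0 \<le> r"
    have *: "q' (r *\<^sub>R x) \<le> r * (q (x + t *\<^sub>R y) - t * q y)" if "0 \<le> t" for t
      using le[of "r * t" "r *\<^sub>R x"] that r sublinear_fun_scaleR[OF q r, of "x + t *\<^sub>R y"]
      by (simp add: algebra_simps)
    show "q' (r *\<^sub>R x) \<le> r * q' x"
    proof (cases "r = 0")
      case True
      then show ?thesis using *[of 0] by simp
    next
      case False
      then have "q' (r *\<^sub>R x) / r \<le> q' x"
        unfolding q'_def[THEN fun_cong, of x]
        by (intro cINF_greatest) (use * r in \<open>auto simp: field_simps\<close>)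
      then show ?thesis using False r by (simp add: field_simps)
    qed
  qed
  then show thesis
    using that[of q'] le[of 0] le[of 1] by simp
qed

text \<open>A minimal sublinear functional cannot be lowered by \<open>sublinear_fun_lower\<close>, which makes it additive.\<close>

theorem hahn_banach_sublinear:
  fixes p :: "'a::real_vector \<Rightarrow> real"
  assumes p: "sublinear_fun p"
  obtains f where "linear f" "\<And>x. f x \<le> p x"
proof -
  define A where "A = {q. sublinear_fun q \<and> q \<le> p}"
  \<comment> \<open>The order is reversed: a maximal element for \<open>P\<close> is a minimal
    sublinear functional below \<open>p\<close>.\<close>
  define P where "P = (\<lambda>q q' :: 'a \<Rightarrow> real. q' \<le> q)"
  have "\<exists>m\<in>A. \<forall>a\<in>A. P m a \<longrightarrow> a = m"
  proof (rule predicate_Zorn)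
    show "partial_order_on A (relation_of P A)"
      by (rule partial_order_on_relation_ofI) (auto simp: P_def)
  next
    fix C assume "C \<in> Chains (relation_of P A)"
    then have CA: "C \<subseteq> A" and tot: "\<And>a b. a \<in> C \<Longrightarrow> b \<in> C \<Longrightarrow> a \<le> b \<or> b \<le> a"
      unfolding Chains_def relation_of_def P_def by auto
    show "\<exists>u\<in>A. \<forall>a\<in>C. P a u"
    proof (cases "C = {}")
      case True
      then show ?thesis using p by (auto simp: A_def)
    next
      case False
      define u where "u = (\<lambda>x. INF q\<in>C. q x)"
      have bdd: "bdd_below ((\<lambda>q. q x) ` C)" for x
      proof (rule bdd_belowI2)
        fix q assume "q \<in> C"
        then have "sublinear_fun q" "q (- x) \<le> p (- x)" using CA by (auto simp: A_def le_fun_def)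
        then show "- p (- x) \<le> q x" using sublinear_fun_minus[of q x] by linarith
      qed
      have le: "u x \<le> q x" if "q \<in> C" for q x
        unfolding u_def using that by (intro cINF_lower bdd)
      have sub: "sublinear_fun q" if "q \<in> C" for q using that CA by (auto simp: A_def)
      have "sublinear_fun u"
        unfolding sublinear_fun_def
      proof (intro conjI allI impI)
        fix x y
        \<comment> \<open>A pointwise infimum need not be subadditive in general; along a chain the
          smaller of \<open>q\<close> and \<open>q'\<close> serves for both terms.\<close>
        have *: "u (x + y) \<le> q x + q' y" if q: "q \<in> C" "q' \<in> C" for q q'
          using tot[OF q]
        proof
          assume "q \<le> q'"
          then have "q y \<le> q' y" by (simp add: le_fun_def)
          then show ?thesis
            using le[OF q(1), of "x + y"] sublinear_fun_add[OF sub[OF q(1)], of x y] by linarith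
        next
          assume "q' \<le> q"
          then have "q' x \<le> q x" by (simp add: le_fun_def)
          then show ?thesis
            using le[OF q(2), of "x + y"] sublinear_fun_add[OF sub[OF q(2)], of x y] by linarith
        qed
        have "u (x + y) - q' y \<le> u x" if "q' \<in> C" for q'
          unfolding u_def[THEN fun_cong, of x]
          by (rule cINF_greatest[OF False]) (use *[OF _ that] in \<open>auto simp: algebra_simps\<close>)
        then have "u (x + y) - u x \<le> u y"
          unfolding u_def[THEN fun_cong, of y]
          by (intro cINF_greatest False) (auto simp: algebra_simps)
        then show "u (x + y) \<le> u x + u y" by simp
      next
        fix r :: real and x assume r: "0 \<le> r"
        have *: "u (r *\<^sub>R x) \<le> r * q x" if "q \<in> C" for q
          using le[OF that, of "r *\<^sub>R x"] sublinear_fun_scaleR[OF sub[OF that] r, of x] by simp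
        show "u (r *\<^sub>R x) \<le> r * u x"
        proof (cases "r = 0")
          case True
          then show ?thesis using * False by auto
        next
          case False
          then have "u (r *\<^sub>R x) / r \<le> u x"
            unfolding u_def[THEN fun_cong, of x]
            by (intro cINF_greatest \<open>C \<noteq> {}\<close>) (use * r in \<open>auto simp: field_simps\<close>)
          then show ?thesis using False r by (simp add: field_simps)
        qed
      qed
      moreover obtain q where "q \<in> C" using False by blast
      then have "u \<le> q" "q \<le> p" using le CA by (auto simp: A_def le_fun_def)
      then have "u \<le> p" by (rule order_trans)
      ultimately show ?thesis
        using le by (intro bexI[of _ u]) (auto simp: A_def P_def le_fun_def)
    qed
  qed
  then obtain f where f: "sublinear_fun f" "f \<le> p" and min: "\<And>q. q \<in> A \<Longrightarrow> q \<le> f \<Longrightarrow> q = f"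
    by (auto simp: A_def P_def)
  have add: "f (x + y) = f x + f y" for x y
  proof -
    obtain q where q: "sublinear_fun q" "\<And>x. q x \<le> f x" "\<And>x. q x \<le> f (x + y) - f y"
      using sublinear_fun_lower[OF f(1)] by metis
    then have "q = f"
      using f(2) by (intro min) (auto simp: A_def le_fun_def order_trans[OF q(2)])
    then show ?thesis
      using q(3)[of x] sublinear_fun_add[OF f(1), of x y] by simp
  qed
  have minus: "f (- x) = - f x" for x
    using add[of x "- x"] sublinear_fun_zero[OF f(1)] by simp
  have "f (r *\<^sub>R x) = r * f x" for r x
  proof (cases "0 \<le> r")
    case False
    then have "f ((- r) *\<^sub>R x) = (- r) * f x" by (intro sublinear_fun_scaleR f(1)) simp
    then show ?thesis using minus[of "r *\<^sub>R x"] by simp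
  qed (simp add: sublinear_fun_scaleR f(1))
  then have "linear f" using add by (intro linearI) auto
  then show thesis using that f(2) by (auto simp: le_fun_def)
qed

text \<open>The norm is lowered in direction \<open>z\<close> before Hahn-Banach is applied, which
  forces the value at \<open>- z\<close> to be at most \<open>- norm z\<close>; no functional on a
  subspace has to be extended.\<close>

lemma exists_norming_functional:
  fixes z :: "'a::real_normed_vector"
  obtains f :: "'a \<Rightarrow> real" where "linear f" "\<And>x. \<bar>f x\<bar> \<le> norm x" "f z = norm z"
proof -
  obtain q where q: "sublinear_fun q" "\<And>x. q x \<le> norm x" "\<And>x. q x \<le> norm (x + z) - norm z"
    using sublinear_fun_lower[OF sublinear_fun_norm] by metis
  obtain f where f: "linear f" "\<And>x. f x \<le> q x"
    using hahn_banach_sublinear[OF q(1)] by metis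
  have le: "f x \<le> norm x" for x using f(2)[of x] q(2)[of x] by linarith
  have minus: "f (- x) = - f x" for x using f(1) by (rule linear_neg)
  have "\<bar>f x\<bar> \<le> norm x" for x using le[of x] le[of "- x"] minus[of x] by simp
  moreover have "f z = norm z"
    using f(2)[of "- z"] q(3)[of "- z"] minus[of z] le[of z] by simp
  ultimately show thesis using that f(1) by blast
qed

section \<open>Bilinear maps on tensor products\<close>

lemma lookup_scaleR: "Poly_Mapping.lookup (r *\<^sub>R u) p = r *\<^sub>R Poly_Mapping.lookup u p"
  by (simp add: scaleR_poly_mapping_def)

text \<open>The universal property: the linear extension of \<open>h\<close> to the free space kills
  the bilinearity relations and so factors through the quotient.\<close>

lemma tensor_lift:
  fixes h :: "'a::real_vector \<Rightarrow> 'b::real_vector \<Rightarrow> 'c::real_vector"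
  assumes h: "bilinear h"
  obtains L :: "('a, 'b) tensor \<Rightarrow> 'c" where "linear L" "\<And>x y. L (pure_tensor x y) = h x y"
proof -
  define lin :: "('a \<times> 'b \<Rightarrow>\<^sub>0 real) \<Rightarrow> 'c" where
    "lin = (\<lambda>u. \<Sum>p\<in>Poly_Mapping.keys u. Poly_Mapping.lookup u p *\<^sub>R (case p of (x, y) \<Rightarrow> h x y))"
  \<comment> \<open>Any finite set containing the support gives the same sum, so elements with
    different supports can be compared over one index set.\<close>
  have lin_eq: "lin u = (\<Sum>p\<in>K. Poly_Mapping.lookup u p *\<^sub>R (case p of (x, y) \<Rightarrow> h x y))"
    if "finite K" "Poly_Mapping.keys u \<subseteq> K" for u K
    unfolding lin_def using that by (intro sum.mono_neutral_left) (auto simp: in_keys_iff)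
  have lin: "linear lin"
  proof (rule linearI)
    fix u v :: "'a \<times> 'b \<Rightarrow>\<^sub>0 real" and r :: real
    let ?K = "Poly_Mapping.keys u \<union> Poly_Mapping.keys v"
    have "Poly_Mapping.keys (u + v) \<subseteq> ?K" by (rule Poly_Mapping.keys_add)
    then show "lin (u + v) = lin u + lin v"
      by (simp add: lin_eq[of ?K] lookup_add scaleR_add_left sum.distrib)
    have "Poly_Mapping.keys (r *\<^sub>R u) \<subseteq> Poly_Mapping.keys u"
      by (auto simp: in_keys_iff lookup_scaleR)
    then show "lin (r *\<^sub>R u) = r *\<^sub>R lin u"
      by (simp add: lin_eq[of "Poly_Mapping.keys u"] lookup_scaleR scaleR_sum_right)
  qed
  have single: "lin (Poly_Mapping.single (x, y) 1) = h x y" for x y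
    by (simp add: lin_def)
  have "lin w = 0" if "w \<in> bilinearity_relations" for w
    using that unfolding bilinearity_relations_def
    by (auto simp: linear_diff[OF lin] linear_scale[OF lin] single bilinear_ladd[OF h]
        bilinear_radd[OF h] bilinear_lmul[OF h] bilinear_rmul[OF h])
  then have zero: "lin w = 0" if "w \<in> span bilinearity_relations" for w
    using linear_eq_0_on_span[OF lin] that by blast
  have cong: "lin u = lin v" if "tensor_rel u v" for u v
    using zero[of "u - v"] that linear_diff[OF lin, of u v] by (simp add: tensor_rel_def)
  define L where "L = (\<lambda>t :: ('a, 'b) tensor. lin (rep_tensor t))"
  have L: "L (abs_tensor u) = lin u" for u
    unfolding L_def
    by (intro cong Quotient3_rep_abs[OF Quotient3_tensor] equivp_reflp[OF equivp_tensor_rel])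
  have "linear L"
  proof (rule linearI)
    fix s t :: "('a, 'b) tensor" and r :: real
    obtain u v where uv: "s = abs_tensor u" "t = abs_tensor v"
      by (metis Quotient3_abs_rep Quotient3_tensor)
    show "L (s + t) = L s + L t"
      by (simp add: uv plus_tensor.abs_eq L linear_add[OF lin])
    show "L (r *\<^sub>R s) = r *\<^sub>R L s"
      by (simp add: uv scaleR_tensor.abs_eq L linear_scale[OF lin])
  qed
  moreover have "L (pure_tensor x y) = h x y" for x y
    by (simp add: pure_tensor.abs_eq L single)
  ultimately show thesis using that by blast
qed

text \<open>Each representation of \<open>t\<close> bounds \<open>norm (L t)\<close> by its cost,
  hence so does the infimum. This later makes contraction with a unit vector continuous.\<close>

lemma norm_le_projective_norm:
  fixes L :: "('a::real_normed_vector, 'b::real_normed_vector) tensor \<Rightarrow> 'c::real_normed_vector"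
  assumes "linear L" and pure: "\<And>x y. norm (L (pure_tensor x y)) \<le> norm x * norm y"
  shows "norm (L t) \<le> projective_norm t"
proof (rule field_le_epsilon)
  fix e :: real assume "e > 0"
  then obtain ts where ts: "t = (\<Sum>(x, y)\<leftarrow>ts. pure_tensor x y)"
    "(\<Sum>(x, y)\<leftarrow>ts. norm x * norm y) < projective_norm t + e"
    using projective_norm_less[of t "projective_norm t + e"] by auto
  have "norm (L (\<Sum>(x, y)\<leftarrow>ts. pure_tensor x y)) \<le> (\<Sum>(x, y)\<leftarrow>ts. norm x * norm y)"
  proof (induction ts)
    case (Cons p ts)
    obtain x y where p: "p = (x, y)" by fastforce
    show ?case
      using Cons pure[of x y] norm_triangle_ineq[of "L (pure_tensor x y)"]
      by (simp add: p linear_add[OF assms(1)]) (smt (verit))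
  qed (simp add: linear_0[OF assms(1)])
  then show "norm (L t) \<le> projective_norm t + e" using ts by simp
qed

lemma of_tensor_zero: "of_tensor 0 = 0"
  using of_tensor_scaleR[of 0 0] by simp

lemma norm_of_tensor_pure_le: "norm (of_tensor (pure_tensor x y)) \<le> norm x * norm y"
  using projective_norm_le[of "[(x, y)]"] by (simp add: norm_of_tensor)

lemma bounded_bilinear_of_tensor_pure: "bounded_bilinear (\<lambda>x y. of_tensor (pure_tensor x y))"
  by standard (auto simp: pure_tensor_add_left pure_tensor_add_right pure_tensor_scaleR_left
      pure_tensor_scaleR_right of_tensor_add of_tensor_scaleR norm_of_tensor_pure_le
      intro!: exI[of _ 1])

section \<open>Rigidity of norm attaining bilinear forms\<close>

text \<open>Smoothness of an inner product norm: the functional attaining its bound at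
  \<open>y\<close> is determined by \<open>y\<close>. A quadratic form replaces Riesz
  representation.\<close>

lemma linear_attaining_norm:
  fixes g :: "'b::real_inner \<Rightarrow> real"
  assumes g: "linear g" and le: "\<And>w. \<bar>g w\<bar> \<le> M * norm w" and M: "M > 0"
    and y: "y \<noteq> 0" "g y = M * norm y"
  shows "g w = M / norm y * (y \<bullet> w)"
proof -
  define b where "b = M\<^sup>2 * (y \<bullet> w) - g y * g w"
  define c where "c = M\<^sup>2 * (w \<bullet> w) - (g w)\<^sup>2"
  \<comment> \<open>\<open>\<lambda>v. M\<^sup>2 * (v \<bullet> v) - (g v)\<^sup>2\<close> is a positive semidefinite quadratic form vanishing at \<open>y\<close>.\<close>
  have Q: "(g v)\<^sup>2 \<le> M\<^sup>2 * (v \<bullet> v)" for v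
    using power_mono[OF le[of v], of 2] by (simp add: power_mult_distrib power2_norm_eq_inner)
  have pos: "0 \<le> 2 * s * b + s\<^sup>2 * c" for s
  proof -
    have "M\<^sup>2 * ((y + s *\<^sub>R w) \<bullet> (y + s *\<^sub>R w)) - (g (y + s *\<^sub>R w))\<^sup>2 =
        (M\<^sup>2 * (y \<bullet> y) - (g y)\<^sup>2) + 2 * s * b + s\<^sup>2 * c"
      unfolding b_def c_def
      by (simp add: linear_add[OF g] linear_scale[OF g] inner_add inner_commute[of w y]
          power2_eq_square algebra_simps)
    then show ?thesis
      using Q[of "y + s *\<^sub>R w"] y(2) by (simp add: power_mult_distrib power2_norm_eq_inner)
  qed
  have c: "0 \<le> c" using Q[of w] by (simp add: c_def)
  have "b = 0"
  proof (rule ccontr)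
    assume "b \<noteq> 0"
    \<comment> \<open>Near the minimiser \<open>- b / c\<close> of the quadratic in
      \<open>s\<close>; the \<open>+ 1\<close> covers \<open>c = 0\<close>.\<close>
    define s where "s = - b / (c + 1)"
    have sb: "b = - s * (c + 1)" using c by (simp add: s_def)
    have "2 * s * b + s\<^sup>2 * c = - (s\<^sup>2 * (c + 2))"
      by (simp add: sb power2_eq_square algebra_simps)
    moreover have "s \<noteq> 0" using \<open>b \<noteq> 0\<close> sb by auto
    then have "s\<^sup>2 * (c + 2) > 0" using c by (intro mult_pos_pos) auto
    ultimately show False using pos[of s] by linarith
  qed
  then show ?thesis
    using M y by (simp add: b_def field_simps power2_eq_square)
qed

text \<open>The common kernel of \<open>N\<close> functionals has finite codimension. In the
  induction, a functional not vanishing on the kernel so far adds one vector \<open>k\<close> of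
  that kernel, and a correction along \<open>k\<close> leaves the earlier functionals
  unchanged.\<close>

lemma exists_finite_complement:
  fixes f :: "nat \<Rightarrow> 'a::real_vector \<Rightarrow> real"
  assumes "\<And>i. linear (f i)"
  shows "\<exists>U. finite U \<and> (\<forall>x. \<exists>u\<in>span U. \<forall>i<N. f i (x - u) = 0)"
proof (induction N)
  case 0
  show ?case by (intro exI[of _ "{}"]) simp
next
  case (Suc N)
  then obtain U where U: "finite U" "\<And>x. \<exists>u\<in>span U. \<forall>i<N. f i (x - u) = 0" by blast
  show ?case
  proof (cases "\<exists>k. (\<forall>i<N. f i k = 0) \<and> f N k \<noteq> 0")
    case False
    then show ?thesis using U by (metis less_antisym)
  next
    case True
    then obtain k where k: "\<And>i. i < N \<Longrightarrow> f i k = 0" "f N k \<noteq> 0" by blast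
    have "\<exists>u\<in>span (insert k U). \<forall>i<Suc N. f i (x - u) = 0" for x
    proof -
      obtain u where u: "u \<in> span U" "\<And>i. i < N \<Longrightarrow> f i (x - u) = 0" using U(2) by blast
      define u' where "u' = u + (f N (x - u) / f N k) *\<^sub>R k"
      have "u' \<in> span (insert k U)"
        unfolding u'_def using u(1)
        by (intro span_add span_scale) (auto intro: span_base span_mono[THEN subsetD])
      moreover have "f i (x - u') = f i (x - u) - (f N (x - u) / f N k) * f i k" for i
        unfolding u'_def diff_diff_eq[symmetric] linear_diff[OF assms] linear_scale[OF assms]
        by simp
      then have "f i (x - u') = 0" if "i < Suc N" for i
        using that k u(2) by (cases "i = N") auto
      ultimately show ?thesis by blast
    qed
    then show ?thesis using U(1) by (intro exI[of _ "insert k U"]) simp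
  qed
qed

text \<open>Both sides are linear in \<open>y\<close>, so it suffices to check \<open>C\<close>
  itself. The zero vector may lie in \<open>C\<close>; its term is zero.\<close>

lemma orthogonal_expansion:
  fixes C :: "'b::real_inner set"
  assumes C: "finite C" "pairwise orthogonal C" and y: "y \<in> span C"
  shows "y = (\<Sum>c\<in>C. (c \<bullet> y / (c \<bullet> c)) *\<^sub>R c)"
proof -
  have "linear (\<lambda>y. \<Sum>c\<in>C. (c \<bullet> y / (c \<bullet> c)) *\<^sub>R c)"
    by (rule linearI)
      (simp_all add: inner_add_right add_divide_distrib scaleR_add_left sum.distrib scaleR_sum_right)
  moreover have "d = (\<Sum>c\<in>C. (c \<bullet> d / (c \<bullet> c)) *\<^sub>R c)" if d: "d \<in> C" for d
  proof -
    have "(c \<bullet> d / (c \<bullet> c)) *\<^sub>R c = (if c = d then d else 0)" if "c \<in> C" for c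
      using C(2) that d by (auto simp: pairwise_def orthogonal_def)
    then show ?thesis using C(1) d by simp
  qed
  ultimately show ?thesis
    using linear_eq_on_span[OF linear_id, of "\<lambda>y. \<Sum>c\<in>C. (c \<bullet> y / (c \<bullet> c)) *\<^sub>R c" C y] y by simp
qed

text \<open>
  The form \<open>b\<close> plays the role of an operator \<open>T\<close> into the dual of \<open>'b\<close>. If it attains its norm at
  \<open>x\<^sub>0\<close>, then so does it at \<open>x\<^sub>0 + t v\<close> for small \<open>t\<close> and \<open>v\<close> in the kernel of the local coordinates,
  and all these are sent to the same functional; hence \<open>T\<close> has finite rank.
\<close>

lemma finite_rank_of_norm_attaining:
  fixes b :: "'a::real_normed_vector \<Rightarrow> 'b::real_inner \<Rightarrow> real"
  assumes ldf: "norm_locally_depends_finitely TYPE('a)"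
    and b: "bounded_bilinear b" and le: "\<And>x y. \<bar>b x y\<bar> \<le> norm x * norm y"
    and att: "x\<^sub>0 \<noteq> 0" "y\<^sub>0 \<noteq> 0" "b x\<^sub>0 y\<^sub>0 = norm x\<^sub>0 * norm y\<^sub>0"
  obtains U where "finite U" "\<And>x. \<exists>u\<in>span U. \<forall>y. b x y = b u y"
proof -
  interpret b: bounded_bilinear b by (rule b)
  obtain \<epsilon> N and f :: "nat \<Rightarrow> 'a \<Rightarrow>\<^sub>L real" and \<phi> where \<epsilon>: "\<epsilon> > 0"
    and \<phi>: "\<And>y. norm (y - x\<^sub>0) < \<epsilon> \<Longrightarrow>
        norm y = \<phi> (\<lambda>i. if i < N then blinfun_apply (f i) y else 0)"
    using ldf att(1) unfolding norm_locally_depends_finitely_def by metis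
  have lin: "linear (blinfun_apply (f i))" for i
    by (simp add: blinfun.bounded_linear_right bounded_linear.linear)
  obtain U where U: "finite U" "\<And>x. \<exists>u\<in>span U. \<forall>i<N. blinfun_apply (f i) (x - u) = 0"
    using exists_finite_complement[of "\<lambda>i. blinfun_apply (f i)", OF lin] by metis
  have ker: "b v w = 0" if v: "\<And>i. i < N \<Longrightarrow> blinfun_apply (f i) v = 0" for v w
  proof -
    \<comment> \<open>Small enough to keep both points \<open>x\<^sub>0 \<plusminus> t v\<close> in
      the ball where the local coordinates are valid; the \<open>+ 1\<close> covers
      \<open>v = 0\<close>.\<close>
    define t where "t = \<epsilon> / (2 * (norm v + 1))"
    have t: "t > 0" using \<epsilon> by (simp add: t_def add_nonneg_pos)
    have small: "t * norm v < \<epsilon>"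
    proof -
      have "t * norm v \<le> t * (norm v + 1)" using t by simp
      also have "t * (norm v + 1) = \<epsilon> / 2"
        using add_nonneg_pos[OF norm_ge_zero[of v] zero_less_one]
        by (simp add: t_def nonzero_divide_eq_eq)
      finally show ?thesis using \<epsilon> by simp
    qed
    have same: "norm (x\<^sub>0 + s *\<^sub>R v) = norm x\<^sub>0" if "\<bar>s\<bar> = t" for s
    proof -
      have "norm (x\<^sub>0 + s *\<^sub>R v) =
          \<phi> (\<lambda>i. if i < N then blinfun_apply (f i) (x\<^sub>0 + s *\<^sub>R v) else 0)"
        using small that by (intro \<phi>) simp
      also have "(\<lambda>i. if i < N then blinfun_apply (f i) (x\<^sub>0 + s *\<^sub>R v) else 0) =
          (\<lambda>i. if i < N then blinfun_apply (f i) x\<^sub>0 else 0)"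
        using v by (auto simp: blinfun.add_right blinfun.scaleR_right)
      also have "\<phi> \<dots> = norm x\<^sub>0" using \<phi>[of x\<^sub>0] \<epsilon> by simp
      finally show ?thesis .
    qed
    have bd: "b (x\<^sub>0 + s *\<^sub>R v) y\<^sub>0 \<le> norm x\<^sub>0 * norm y\<^sub>0" if "\<bar>s\<bar> = t" for s
      using le[of "x\<^sub>0 + s *\<^sub>R v" y\<^sub>0] same[OF that] by simp
    \<comment> \<open>An affine function of \<open>s\<close> that is nowhere above its value at
      \<open>0\<close> for \<open>s = t\<close> and \<open>s = - t\<close> has slope zero.\<close>
    have "t * b v y\<^sub>0 = 0"
      using bd[of t] bd[of "- t"] t att(3) by (simp add: b.add_left b.diff_left b.scaleR_left)
    then have y0: "b (x\<^sub>0 + s *\<^sub>R v) y\<^sub>0 = norm x\<^sub>0 * norm y\<^sub>0" for s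
      using att(3) t by (simp add: b.add_left b.scaleR_left)
    have eq: "b (x\<^sub>0 + s *\<^sub>R v) w = norm x\<^sub>0 / norm y\<^sub>0 * (y\<^sub>0 \<bullet> w)" if "\<bar>s\<bar> = t" for s
    proof (rule linear_attaining_norm)
      show "linear (b (x\<^sub>0 + s *\<^sub>R v))"
        by (simp add: b.bounded_linear_right bounded_linear.linear)
      show "\<bar>b (x\<^sub>0 + s *\<^sub>R v) w\<bar> \<le> norm x\<^sub>0 * norm w" for w
        using le[of "x\<^sub>0 + s *\<^sub>R v" w] same[OF that] by simp
    qed (use att y0 in auto)
    have "b (x\<^sub>0 + t *\<^sub>R v) w = b (x\<^sub>0 + (- t) *\<^sub>R v) w"
      using eq[of t] eq[of "- t"] t by simp
    then have "t * b v w = 0"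
      by (simp add: b.add_left b.diff_left b.scaleR_left)
    then show ?thesis using t by simp
  qed
  have "\<exists>u\<in>span U. \<forall>y. b x y = b u y" for x
  proof -
    obtain u where u: "u \<in> span U" "\<And>i. i < N \<Longrightarrow> blinfun_apply (f i) (x - u) = 0"
      using U(2) by blast
    have "b x y = b u y" for y using ker[OF u(2), of y] by (simp add: b.diff_left)
    then show ?thesis using u(1) by blast
  qed
  then show thesis using that U(1) by blast
qed

text \<open>The embedding of \<open>'b\<close> into its dual is linear and injective, so an
  independent subset of \<open>Y\<close> stays independent inside \<open>span F\<close> and must be
  finite.\<close>

lemma finite_span_of_inner_in_span:
  fixes Y :: "'b::real_inner set"
  assumes F: "finite F" and Y: "\<And>y. y \<in> Y \<Longrightarrow> blinfun_inner_right y \<in> span F"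
  obtains D where "finite D" "Y \<subseteq> span D"
proof -
  have lin: "linear (blinfun_inner_right :: 'b \<Rightarrow> _)"
    by (simp add: bounded_linear_blinfun_inner_right bounded_linear.linear)
  have inj: "inj (blinfun_inner_right :: 'b \<Rightarrow> _)"
  proof (rule injI)
    fix x y :: 'b assume "blinfun_inner_right x = blinfun_inner_right y"
    then have "x \<bullet> w = y \<bullet> w" for w by (metis blinfun_inner_right.rep_eq)
    then show "x = y" by (metis inner_commute vector_eq_rdot)
  qed
  obtain D where D: "D \<subseteq> Y" "independent D" "Y \<subseteq> span D"
    by (rule maximal_independent_subset)
  have "independent (blinfun_inner_right ` D)"
    by (rule linear_independent_injective_image[OF lin D(2) inj_on_subset[OF inj]]) simp
  moreover have "blinfun_inner_right ` D \<subseteq> span F" using D(1) Y by auto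
  ultimately have "finite (blinfun_inner_right ` D)"
    using independent_span_bound[OF F] by blast
  then have "finite D" by (rule finite_imageD) (rule inj_on_subset[OF inj], simp)
  then show thesis using that D(3) by blast
qed

section \<open>Norm attaining tensors have finite rank\<close>

lemma range_of_tensor_sum:
  assumes "\<And>c. c \<in> C \<Longrightarrow> g c \<in> range of_tensor"
  shows "sum g C \<in> range of_tensor"
  using assms
proof (induction C rule: infinite_finite_induct)
  case (insert c C)
  then have "g c \<in> range of_tensor" "sum g C \<in> range of_tensor" by blast+
  then obtain s t where "g c = of_tensor s" "sum g C = of_tensor t" by (elim imageE) (rule that)
  then have "sum g (insert c C) = of_tensor (s + t)" using insert.hyps by (simp add: of_tensor_add)
  then show ?case by blast
qed (use of_tensor_zero in \<open>auto intro: range_eqI[OF sym]\<close>)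

text \<open>Expanding each \<open>y n\<close> in a finite orthogonal set \<open>C\<close> moves the
  coefficients to the first factor. Cauchy-Schwarz makes the resulting series in \<open>'a\<close>
  absolutely convergent, one for each element of \<open>C\<close>.\<close>

lemma sums_in_range_of_tensor:
  fixes x :: "nat \<Rightarrow> 'a::banach" and y :: "nat \<Rightarrow> 'b::real_inner"
  assumes z: "(\<lambda>n. of_tensor (pure_tensor (x n) (y n))) sums z"
    and summable: "summable (\<lambda>n. norm (x n) * norm (y n))"
    and D: "finite D" "\<And>n. y n \<in> span D"
  shows "z \<in> range of_tensor"
proof -
  interpret pt: bounded_bilinear "\<lambda>(x::'a) (y::'b). of_tensor (pure_tensor x y)"
    by (rule bounded_bilinear_of_tensor_pure)
  obtain C where C: "finite C" "pairwise orthogonal C" "span C = span D"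
    using basis_orthogonal[OF D(1)] by blast
  define a where "a = (\<lambda>c n. (c \<bullet> y n / (c \<bullet> c)) *\<^sub>R x n)"
  have "summable (a c)" for c
  proof (rule summable_norm_cancel, rule summable_comparison_test)
    show "summable (\<lambda>n. norm c / (c \<bullet> c) * (norm (x n) * norm (y n)))"
      by (intro summable_mult summable)
    have "\<bar>c \<bullet> y n\<bar> / (c \<bullet> c) * norm (x n) \<le> norm c * norm (y n) / (c \<bullet> c) * norm (x n)" for n
      by (intro mult_right_mono divide_right_mono Cauchy_Schwarz_ineq2) auto
    then show "\<exists>N. \<forall>n\<ge>N. norm (norm (a c n)) \<le> norm c / (c \<bullet> c) * (norm (x n) * norm (y n))"
      by (simp add: a_def mult_ac)
  qed
  then have "(\<lambda>n. of_tensor (pure_tensor (a c n) c)) sums of_tensor (pure_tensor (suminf (a c)) c)" for c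
    by (intro bounded_linear.sums[OF pt.bounded_linear_left] summable_sums)
  then have "(\<lambda>n. \<Sum>c\<in>C. of_tensor (pure_tensor (a c n) c)) sums
      (\<Sum>c\<in>C. of_tensor (pure_tensor (suminf (a c)) c))"
    by (intro sums_sum)
  moreover have "(\<Sum>c\<in>C. of_tensor (pure_tensor (a c n) c)) = of_tensor (pure_tensor (x n) (y n))" for n
  proof -
    have "of_tensor (pure_tensor (x n) (y n)) =
        of_tensor (pure_tensor (x n) (\<Sum>c\<in>C. (c \<bullet> y n / (c \<bullet> c)) *\<^sub>R c))"
      using orthogonal_expansion[OF C(1,2), of "y n"] D(2) C(3) by simp
    then show ?thesis
      by (simp add: pt.sum_right pt.scaleR_right pt.scaleR_left a_def)
  qed
  ultimately have "z = (\<Sum>c\<in>C. of_tensor (pure_tensor (suminf (a c)) c))"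
    using z sums_unique2 by simp
  then show ?thesis by (simp add: range_of_tensor_sum)
qed

lemma NA_projective_subset:
  assumes ldf: "norm_locally_depends_finitely TYPE('a::banach)"
  shows "(NA_projective :: ('a, 'b::real_inner) proj_tensor set) \<subseteq> range of_tensor"
proof
  fix z :: "('a, 'b) proj_tensor" assume "z \<in> NA_projective"
  then obtain x y where sn: "(\<lambda>n. norm (x n) * norm (y n)) sums norm z"
    and sz: "(\<lambda>n. of_tensor (pure_tensor (x n) (y n))) sums z"
    unfolding NA_projective_def by blast
  interpret pt: bounded_bilinear "\<lambda>(x::'a) (y::'b). of_tensor (pure_tensor x y)"
    by (rule bounded_bilinear_of_tensor_pure)
  obtain f :: "('a, 'b) proj_tensor \<Rightarrow> real"
    where f: "linear f" "\<And>w. \<bar>f w\<bar> \<le> norm w" "f z = norm z"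
    using exists_norming_functional by metis
  have blf: "bounded_linear f"
    using f(1,2) by (auto simp: bounded_linear_def bounded_linear_axioms_def intro!: exI[of _ 1])
  define b where "b = (\<lambda>(x::'a) (y::'b). f (of_tensor (pure_tensor x y)))"
  have le: "\<bar>b x y\<bar> \<le> norm x * norm y" for x y
    unfolding b_def using f(2) norm_of_tensor_pure_le order_trans by blast
  have b: "bounded_bilinear b"
  proof
    show "\<exists>K. \<forall>x y. norm (b x y) \<le> norm x * norm y * K"
      using le by (intro exI[of _ 1]) simp
  qed (simp_all add: b_def pt.add_left pt.add_right pt.scaleR_left pt.scaleR_right
      linear_add[OF f(1)] linear_scale[OF f(1)])
  interpret b: bounded_bilinear b by (rule b)
  have att: "b (x n) (y n) = norm (x n) * norm (y n)" for n
  proof -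
    have "(\<lambda>n. b (x n) (y n)) sums norm z"
      using bounded_linear.sums[OF blf sz] f(3) by (simp add: b_def)
    \<comment> \<open>A convergent series of nonnegative terms with sum zero has only zero
      terms.\<close>
    from sums_diff[OF sn this]
    have d: "(\<lambda>n. norm (x n) * norm (y n) - b (x n) (y n)) sums 0" by simp
    have "0 \<le> norm (x n) * norm (y n) - b (x n) (y n)" for n
      using abs_le_D1[OF le[of "x n" "y n"]] by simp
    then have "norm (x n) * norm (y n) - b (x n) (y n) = 0"
      using d suminf_eq_zero_iff[OF sums_summable[OF d]] sums_unique[OF d] by simp
    then show ?thesis by simp
  qed
  show "z \<in> range of_tensor"
  proof (cases "\<exists>n. x n \<noteq> 0 \<and> y n \<noteq> 0")
    case False
    then have zero: "(\<lambda>n. norm (x n) * norm (y n)) = (\<lambda>n. 0)" by auto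
    have "norm z = 0" using sn unfolding zero by (simp add: sums_iff)
    then have "z = of_tensor 0" by (simp add: of_tensor_zero)
    then show ?thesis by blast
  next
    case True
    then obtain U where U: "finite U" "\<And>x. \<exists>u\<in>span U. \<forall>y. b x y = b u y"
      using finite_rank_of_norm_attaining[OF ldf b le] att by metis
    \<comment> \<open>The form read as an operator into the dual of \<open>'b\<close>, where finite
      rank becomes a statement about spans.\<close>
    define S where "S = (\<lambda>x. Blinfun (b x))"
    have S: "blinfun_apply (S x) y = b x y" for x y
      unfolding S_def by (simp add: bounded_linear_Blinfun_apply b.bounded_linear_right)
    have linS: "linear S"
      by (rule linearI; rule blinfun_eqI)
        (simp_all add: S blinfun.add_left blinfun.scaleR_left b.add_left b.scaleR_left)
    have rangeS: "S x \<in> span (S ` U)" for x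
    proof -
      obtain u where "u \<in> span U" "\<And>y. b x y = b u y" using U(2) by blast
      then have "S x = S u" "S u \<in> S ` span U" by (auto intro: blinfun_eqI simp: S)
      then show ?thesis by (simp add: linear_span_image[OF linS])
    qed
    \<comment> \<open>If \<open>x n = 0\<close>, the form says nothing about \<open>y n\<close>;
      replacing it by \<open>0\<close> does not change the tensor.\<close>
    define y' where "y' = (\<lambda>n. if x n = 0 then 0 else y n)"
    have inner: "blinfun_inner_right (y' n) \<in> span (S ` U)" for n
    proof (cases "x n = 0 \<or> y n = 0")
      case True
      then have "blinfun_inner_right (y' n) = 0"
        by (auto simp: y'_def intro!: blinfun_eqI)
      then show ?thesis by (simp add: span_zero)
    next
      case False
      \<comment> \<open>\<open>S (x n)\<close> attains its bound \<open>norm (x n)\<close> at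
        \<open>y n\<close>, so it is a nonzero multiple of the inner product with
        \<open>y n\<close>.\<close>
      have "b (x n) w = norm (x n) / norm (y n) * (y n \<bullet> w)" for w
        by (rule linear_attaining_norm)
          (use False le att in \<open>auto simp: b.bounded_linear_right bounded_linear.linear\<close>)
      then have "blinfun_inner_right (y' n) = (norm (y n) / norm (x n)) *\<^sub>R S (x n)"
        using False by (intro blinfun_eqI) (simp add: y'_def S blinfun.scaleR_left)
      then show ?thesis using rangeS by (simp add: span_scale)
    qed
    obtain D where D: "finite D" "range y' \<subseteq> span D"
      by (rule finite_span_of_inner_in_span[of "S ` U" "range y'"]) (use U(1) inner in auto)
    show ?thesis
    proof (rule sums_in_range_of_tensor[where x = x and y = y'])
      have "of_tensor (pure_tensor (x n) (y' n)) = of_tensor (pure_tensor (x n) (y n))" for n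
        by (simp add: y'_def pt.zero_left pt.zero_right)
      then show "(\<lambda>n. of_tensor (pure_tensor (x n) (y' n))) sums z" using sz by simp
      have "(\<lambda>n. norm (x n) * norm (y' n)) = (\<lambda>n. norm (x n) * norm (y n))"
        by (auto simp: y'_def)
      then show "summable (\<lambda>n. norm (x n) * norm (y' n))" using sums_summable[OF sn] by simp
    qed (use D in auto)
  qed
qed

section \<open>The algebraic tensor product is not complete\<close>

lemma exists_independent_sequence:
  assumes "infinite_dimensional TYPE('a::real_vector)"
  obtains x :: "nat \<Rightarrow> 'a::real_vector" where "inj x" "independent (range x)"
proof -
  obtain B :: "'a set" where B: "independent B" "UNIV \<subseteq> span B"
    by (rule maximal_independent_subset)
  then have "infinite B" using assms by (auto simp: infinite_dimensional_def)
  then obtain x :: "nat \<Rightarrow> 'a" where x: "inj x" "range x \<subseteq> B"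
    using infinite_countable_subset by blast
  then show thesis using that B(1) independent_mono by blast
qed

text \<open>One Gram-Schmidt step: \<open>B\<close> is replaced by an orthogonal set with the same
  span, and a vector outside the span is reduced by its projection and normalised.\<close>

lemma exists_unit_orthogonal:
  fixes B :: "'b::real_inner set"
  assumes "infinite_dimensional TYPE('b)" "finite B"
  shows "\<exists>u. norm u = 1 \<and> (\<forall>v\<in>B. v \<bullet> u = 0)"
proof -
  obtain C where C: "finite C" "pairwise orthogonal C" "span C = span B"
    using basis_orthogonal[OF assms(2)] by blast
  obtain y where y: "y \<notin> span B" using assms by (auto simp: infinite_dimensional_def)
  define w where "w = y - (\<Sum>c\<in>C. (c \<bullet> y / (c \<bullet> c)) *\<^sub>R c)"
  have "(\<Sum>c\<in>C. (c \<bullet> y / (c \<bullet> c)) *\<^sub>R c) \<in> span B"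
    unfolding C(3)[symmetric] by (intro span_sum span_scale span_base)
  then have "w \<noteq> 0" using y by (auto simp: w_def)
  have "d \<bullet> w = 0" if d: "d \<in> C" for d
  proof -
    have "d \<bullet> ((c \<bullet> y / (c \<bullet> c)) *\<^sub>R c) = (if c = d then d \<bullet> y else 0)" if "c \<in> C" for c
      using C(2) that d by (auto simp: pairwise_def orthogonal_def)
    then show ?thesis using C(1) d by (simp add: w_def inner_diff_right inner_sum_right)
  qed
  then have "w \<bullet> v = 0" if "v \<in> span C" for v
    using orthogonal_to_span[OF that, of w] by (auto simp: orthogonal_def inner_commute)
  then have "v \<bullet> w = 0" if "v \<in> B" for v
    using that C(3) by (simp add: inner_commute span_base)
  then show ?thesis using \<open>w \<noteq> 0\<close> by (intro exI[of _ "w /\<^sub>R norm w"]) simp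
qed

lemma exists_orthonormal_sequence:
  assumes "infinite_dimensional TYPE('b::real_inner)"
  obtains e :: "nat \<Rightarrow> 'b::real_inner" where "\<And>m n. e m \<bullet> e n = (if m = n then 1 else 0)"
proof -
  have "\<exists>e :: nat \<Rightarrow> 'b. \<forall>n. norm (e n) = 1 \<and> (\<forall>v\<in>e ` {..<n}. v \<bullet> e n = 0)"
  proof (rule dependent_wellorder_choice)
    fix f :: "nat \<Rightarrow> 'b" and n
    show "\<exists>u. norm u = 1 \<and> (\<forall>v\<in>f ` {..<n}. v \<bullet> u = 0)"
      by (rule exists_unit_orthogonal[OF assms]) simp
  qed auto
  then obtain e :: "nat \<Rightarrow> 'b" where e: "\<And>n. norm (e n) = 1" "\<And>m n. m < n \<Longrightarrow> e m \<bullet> e n = 0"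
    by auto
  have "e m \<bullet> e n = (if m = n then 1 else 0)" for m n
    using e(1)[of n] e(2)[of m n] e(2)[of n m]
    by (cases m n rule: linorder_cases) (auto simp: inner_commute norm_eq_1)
  then show thesis using that by blast
qed

text \<open>
  The tensor below is \<open>\<Sum>n. c\<^sub>n x\<^sub>n \<otimes> e\<^sub>n\<close>; contracting with \<open>e\<^sub>k\<close> recovers \<open>c\<^sub>k x\<^sub>k\<close>,
  whereas the contractions of a finite sum of basic tensors span a finite-dimensional space.
\<close>

lemma range_of_tensor_neq_UNIV:
  assumes "infinite_dimensional TYPE('a::real_normed_vector)"
    and "infinite_dimensional TYPE('b::real_inner)"
  obtains z :: "('a::real_normed_vector, 'b::real_inner) proj_tensor" where "z \<notin> range of_tensor"
proof -
  obtain x :: "nat \<Rightarrow> 'a" where x: "inj x" "independent (range x)"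
    using exists_independent_sequence[OF assms(1)] by blast
  obtain e :: "nat \<Rightarrow> 'b" where e: "\<And>m n. e m \<bullet> e n = (if m = n then 1 else 0)"
    using exists_orthonormal_sequence[OF assms(2)] by blast
  have e1: "norm (e n) = 1" for n by (simp add: norm_eq_1 e)
  have x0: "x n \<noteq> 0" for n using x(2) dependent_zero by (metis rangeI)
  \<comment> \<open>Chosen so that the terms have projective norm at most \<open>(1/2)^n\<close>,
    whatever the size of \<open>x n\<close>.\<close>
  define c where "c = (\<lambda>n. (1/2)^n / norm (x n))"
  have c: "c n > 0" for n using x0 by (simp add: c_def)
  define p where "p = (\<lambda>n. pure_tensor (c n *\<^sub>R x n) (e n))"
  have "summable (\<lambda>n. of_tensor (p n))"
  proof (rule summable_norm_cancel, rule summable_comparison_test)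
    show "summable (\<lambda>n. (1/2::real)^n)" by (simp add: summable_geometric)
    have "norm (of_tensor (p n)) \<le> (1/2)^n" for n
      using norm_of_tensor_pure_le[of "c n *\<^sub>R x n" "e n"] x0[of n] by (simp add: p_def e1 c_def)
    then show "\<exists>N. \<forall>n\<ge>N. norm (norm (of_tensor (p n))) \<le> (1/2)^n" by simp
  qed
  then obtain z where z: "(\<lambda>n. of_tensor (p n)) sums z" by (auto simp: summable_def)
  have of_sum: "of_tensor (\<Sum>k<n. p k) = (\<Sum>k<n. of_tensor (p k))" for n
    by (induction n) (simp_all add: of_tensor_zero of_tensor_add)
  have "z \<notin> range of_tensor"
  proof
    assume "z \<in> range of_tensor"
    then obtain w where w: "z = of_tensor w" by blast
    obtain ts where ts: "w = (\<Sum>(x, y)\<leftarrow>ts. pure_tensor x y)" using tensor_exists_sum by blast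
    \<comment> \<open>This puts the whole independent sequence into a finite-dimensional space,
      which is the contradiction.\<close>
    have "x k \<in> span (fst ` set ts)" for k
    proof -
      have "bilinear (\<lambda>(x::'a) y. (e k \<bullet> y) *\<^sub>R x)"
        by (auto simp: bilinear_def linear_iff algebra_simps inner_add_right)
      then obtain L :: "('a, 'b) tensor \<Rightarrow> 'a"
        where L: "linear L" "\<And>x y. L (pure_tensor x y) = (e k \<bullet> y) *\<^sub>R x"
        by (rule tensor_lift) blast
      have "\<bar>e k \<bullet> y\<bar> \<le> norm y" for y using Cauchy_Schwarz_ineq2[of "e k" y] e1 by simp
      then have "norm (L (pure_tensor x y)) \<le> norm x * norm y" for x y
        by (simp add: L(2) mult.commute mult_left_mono)
      then have Lle: "norm (L t) \<le> projective_norm t" for t by (rule norm_le_projective_norm[OF L(1)])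
      have Ls: "L (\<Sum>j<n. p j) = c k *\<^sub>R x k" if "k < n" for n
        using that by (simp add: linear_sum[OF L(1)] p_def L(2) e
              if_distrib[of "\<lambda>r. (r * _) *\<^sub>R _"] cong: if_cong)
      \<comment> \<open>\<open>L\<close> acts on algebraic tensors only, so the partial sums are
        compared with the representative \<open>w\<close> of \<open>z\<close>, and the projective
        norm carries the convergence over to \<open>L\<close>.\<close>
      have "(\<lambda>n. norm (z - of_tensor (\<Sum>j<n. p j))) \<longlonglongrightarrow> 0"
        using z unfolding sums_def of_sum
        by (intro tendsto_norm_zero) (use LIM_zero in \<open>auto intro!: tendsto_eq_intros\<close>)
      then have "(\<lambda>n. norm (L w - c k *\<^sub>R x k)) \<longlonglongrightarrow> 0"
      proof (rule Lim_null_comparison[rotated])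
        have "norm (norm (L w - c k *\<^sub>R x k)) \<le> norm (z - of_tensor (\<Sum>j<n. p j))" if "k < n" for n
          using Lle[of "w - (\<Sum>j<n. p j)"] Ls[OF that]
          by (simp add: linear_diff[OF L(1)] w norm_of_tensor flip: of_tensor_diff)
        then show "\<forall>\<^sub>F n in sequentially.
            norm (norm (L w - c k *\<^sub>R x k)) \<le> norm (z - of_tensor (\<Sum>j<n. p j))"
          using eventually_gt_at_top[of k] by (rule eventually_mono[rotated])
      qed
      then have "L w = c k *\<^sub>R x k" by (simp add: LIMSEQ_const_iff)
      moreover have "L (\<Sum>(x, y)\<leftarrow>us. pure_tensor x y) \<in> span (fst ` set us)" for us
      proof (induction us)
        case (Cons q us)
        obtain a y where q: "q = (a, y)" by fastforce
        have "a \<in> span (fst ` set (q # us))" by (simp add: q span_base)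
        moreover have "L (\<Sum>(x, y)\<leftarrow>us. pure_tensor x y) \<in> span (fst ` set (q # us))"
          using Cons by (rule subsetD[OF span_mono, rotated]) auto
        ultimately have "(e k \<bullet> y) *\<^sub>R a + L (\<Sum>(x, y)\<leftarrow>us. pure_tensor x y)
            \<in> span (fst ` set (q # us))"
          by (intro span_add span_scale)
        then show ?case by (simp add: q linear_add[OF L(1)] L(2))
      qed (simp add: linear_0[OF L(1)])
      ultimately have "c k *\<^sub>R x k \<in> span (fst ` set ts)" using ts by metis
      then have "inverse (c k) *\<^sub>R c k *\<^sub>R x k \<in> span (fst ` set ts)" by (rule span_scale)
      then show ?thesis using c[of k] by simp
    qed
    then have "finite (range x)"
      using independent_span_bound[OF _ x(2), of "fst ` set ts"] by auto
    then show False using x(1) range_inj_infinite by blast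
  qed
  then show thesis using that by blast
qed

theorem theorem3p1:
  assumes "infinite_dimensional TYPE('a::banach)"
    and "norm_locally_depends_finitely TYPE('a)"
    and "infinite_dimensional TYPE('b::{real_inner, banach})"
  shows "(NA_projective :: ('a, 'b) proj_tensor set) \<subseteq> range of_tensor
    \<and> (\<exists>z :: ('a, 'b) proj_tensor. z \<notin> NA_projective)"
proof -
  have sub: "(NA_projective :: ('a, 'b) proj_tensor set) \<subseteq> range of_tensor"
    by (rule NA_projective_subset[OF assms(2)])
  obtain z :: "('a, 'b) proj_tensor" where "z \<notin> range of_tensor"
    using range_of_tensor_neq_UNIV[OF assms(1,3)] by blast
  then show ?thesis using sub by blast
qed

end
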